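(* Let $\mathbb X$ be a Banach space over $\mathbb K=\mathbb R$ or $\mathbb C$ and let $\{\mathbf e_n,\mathbf e_n^*\}_{n=1}^\infty$ be a semi-normalized biorthogonal system in $\mathbb X\times\mathbb X^*$ whose vectors $\mathbf e_n$ have dense span (as in the context). Let $\mathtt K=\sup_{m,n}\|\mathbf e_m\|\,\|\mathbf e_n^*\|$. Then for all $N\ge1$ $$\mathbf L_N\le1+3\,\mathtt K\,N\qquad\text{and}\qquad\nu_N\le\widetilde{\mathbf L}_N\le1+2\,\mathtt K\,N .$$ Moreover, there exists an example of such $(\mathbb X,\mathscr B)$, $\mathscr B=\{\mathbf e_n\}$, for which all the equalities hold, i.e. $\mathbf L_N=1+3\mathtt KN$ and $\nu_N=\widetilde{\mathbf L}_N=1+2\mathtt KN$ for all $N\ge 1$.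
   Context: Setting: $\mathbb X$ is a Banach space over $\mathbb K=\mathbb R$ or $\mathbb C$; $\{\mathbf e_n,\mathbf e_n^*\}_{n=1}^\infty\subset\mathbb X\times\mathbb X^*$ satisfies $\mathbf e_m^*(\mathbf e_n)=\delta_{m,n}$; $\mathscr B=\{\mathbf e_n\}$ has dense linear span in $\mathbb X$; and $0<\kappa_1\le\|\mathbf e_n\|,\|\mathbf e_n^*\|\le\kappa_2<\infty$ for all $n$. (Then $\lim_n\mathbf e_n^*(x)=0$ for all $x\in\mathbb X$.) Projections: for finite $A\subset\mathbb N$, $P_Ax=\sum_{n\in A}\mathbf e_n^*(x)\mathbf e_n$. Greedy sets: a finite set $\Gamma\subset\mathbb N$ is a greedy set for $x$ if $\min_{n\in\Gamma}|\mathbf e_n^*(x)|\ge\max_{n\in\Gamma^c}|\mathbf e_n^*(x)|$; $\mathscr G(x,N)$ is the collection of greedy sets for $x$ of cardinality $N$. $\mathscr G_N$ is the set of all maps $G:\mathbb X\to\mathbb X$ with $Gx=P_{\Gamma_x}x$ for some choice $\Gamma_x\in\mathscr G(x,N)$, for each $x$. Approximation errors: $\Sigma_N=\{\sum_{n\in A}a_n\mathbf e_n: |A|\le N,\ a_n\in\mathbb K\}$, $\sigma_N(x)=\operatorname{dist}(x,\Sigma_N)$, $\widetilde\sigma_N(x)=\inf\{\|x-P_Ax\|: |A|\le N\}$. Lebesgue constants: $\mathbf L_N$ (resp. $\widetilde{\mathbf L}_N$) is the smallest number such that $\|x-Gx\|\le\mathbf L_N\sigma_N(x)$ (resp. $\|x-Gx\|\le\widetilde{\mathbf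 L}_N\widetilde\sigma_N(x)$) for all $x\in\mathbb X$ and all $G\in\mathscr G_N$. $\Upsilon$ is the set of sequences $\boldsymbol\varepsilon=\{\varepsilon_n\}$ in $\mathbb K$ with $|\varepsilon_n|=1$ for all $n$; $\mathbf 1_{\boldsymbol\varepsilon A}=\sum_{n\in A}\varepsilon_n\mathbf e_n$. $\nu_N$ is the supremum of $\|\mathbf 1_{\boldsymbol\varepsilon A}+x\|/\|\mathbf 1_{\boldsymbol\eta B}+x\|$ over all $|A|=|B|\le N$ (nonempty), $\boldsymbol\varepsilon,\boldsymbol\eta\in\Upsilon$, and $x\in\mathbb X$ with $|x|_\infty:=\sup_n|\mathbf e_n^*(x)|\le1$ such that $A$, $B$ and $\operatorname{supp}x=\{n:\mathbf e_n^*(x)\ne0\}$ are pairwise disjoint. *)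

theory Defs
  imports "HOL-Analysis.Analysis"
begin

(* The scalar field is a type 'k :: {real_normed_field, banach}.  Both real and complex belong to
   this sort, and by the Gelfand-Mazur theorem every type of this sort is isometrically isomorphic
   to one of them.  A Banach space over 'k is a complete real normed space 'a with a scalar
   multiplication by 'k that extends the real one and is compatible with the norm.  Completeness is
   an explicit assumption because the function space  enat \<Rightarrow>\<^sub>C 'k  (the continuous functions on
   the one-point compactification of the naturals, a copy of the space c of convergent sequences),
   which serves as the type of the extremal example, has no banach instance in the library. *)

locale banach_space_over = vector_space scale
  for scale :: "'k::{real_normed_field,banach} \<Rightarrow> 'a::real_normed_vector \<Rightarrow> 'a" +
  assumes scale_of_real: "scale (of_real r) x = r *\<^sub>R x"
    and norm_scale: "norm (scale c x) = norm c * norm x"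
    and complete_space: "complete (UNIV :: 'a set)"

(* Elements of the dual space are the bounded real-linear maps to 'k (with their operator norm)
   that are homogeneous over 'k.  The index set is nat, so indices start at 0. *)

locale semi_normalized_system = banach_space_over scale
  for scale :: "'k::{real_normed_field,banach} \<Rightarrow> 'a::real_normed_vector \<Rightarrow> 'a" +
  fixes e :: "nat \<Rightarrow> 'a" and e' :: "nat \<Rightarrow> 'a \<Rightarrow>\<^sub>L 'k"
  assumes dual_scale: "blinfun_apply (e' n) (scale c x) = c * blinfun_apply (e' n) x"
    and biorthogonal: "blinfun_apply (e' m) (e n) = (if m = n then 1 else 0)"
    and dense_span: "closure (module.span scale (range e)) = UNIV"
    and semi_normalized:
      "\<exists>\<kappa>1 \<kappa>2. 0 < \<kappa>1 \<and> (\<forall>n. \<kappa>1 \<le> norm (e n) \<and> norm (e n) \<le> \<kappa>2 \<and>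
                              \<kappa>1 \<le> norm (e' n) \<and> norm (e' n) \<le> \<kappa>2)"

context
  fixes scale :: "'k::{real_normed_field,banach} \<Rightarrow> 'a::real_normed_vector \<Rightarrow> 'a"
    and e :: "nat \<Rightarrow> 'a" and e' :: "nat \<Rightarrow> 'a \<Rightarrow>\<^sub>L 'k"
begin

definition proj :: "nat set \<Rightarrow> 'a \<Rightarrow> 'a" where
  "proj A x = (\<Sum>n\<in>A. scale (blinfun_apply (e' n) x) (e n))"

definition greedy_sets :: "'a \<Rightarrow> nat \<Rightarrow> nat set set" where
  "greedy_sets x N = {\<Gamma>. finite \<Gamma> \<and> card \<Gamma> = N \<and>
     (\<forall>n\<in>\<Gamma>. \<forall>m\<in>- \<Gamma>. norm (blinfun_apply (e' m) x) \<le> norm (blinfun_apply (e' n) x))}"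

definition greedy_maps :: "nat \<Rightarrow> ('a \<Rightarrow> 'a) set" where
  "greedy_maps N = {G. \<forall>x. \<exists>\<Gamma>\<in>greedy_sets x N. G x = proj \<Gamma> x}"

definition sparse_vectors :: "nat \<Rightarrow> 'a set" where
  "sparse_vectors N = {\<Sum>n\<in>A. scale (a n) (e n) | A a. finite A \<and> card A \<le> N}"

definition best_error :: "nat \<Rightarrow> 'a \<Rightarrow> real" where
  "best_error N x = infdist x (sparse_vectors N)"

definition proj_error :: "nat \<Rightarrow> 'a \<Rightarrow> real" where
  "proj_error N x = (INF A\<in>{A. finite A \<and> card A \<le> N}. norm (x - proj A x))"

(* The optimal constants are extended reals; they are infinite if no real constant is admissible. *)

definition lebesgue_const :: "nat \<Rightarrow> ereal" where
  "lebesgue_const N =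
     (INF C\<in>{C::real. \<forall>x. \<forall>G\<in>greedy_maps N. norm (x - G x) \<le> C * best_error N x}. ereal C)"

definition lebesgue_const_proj :: "nat \<Rightarrow> ereal" where
  "lebesgue_const_proj N =
     (INF C\<in>{C::real. \<forall>x. \<forall>G\<in>greedy_maps N. norm (x - G x) \<le> C * proj_error N x}. ereal C)"

definition supp :: "'a \<Rightarrow> nat set" where
  "supp x = {n. blinfun_apply (e' n) x \<noteq> 0}"

definition coeff_sup :: "'a \<Rightarrow> real" where
  "coeff_sup x = (SUP n. norm (blinfun_apply (e' n) x))"

definition unimodular :: "(nat \<Rightarrow> 'k) set" where
  "unimodular = {\<epsilon>. \<forall>n. norm (\<epsilon> n) = 1}"

definition signed_indicator :: "(nat \<Rightarrow> 'k) \<Rightarrow> nat set \<Rightarrow> 'a" where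
  "signed_indicator \<epsilon> A = (\<Sum>n\<in>A. scale (\<epsilon> n) (e n))"

definition democracy_const :: "nat \<Rightarrow> ereal" where
  "democracy_const N = Sup {ereal (norm (signed_indicator \<epsilon> A + x) / norm (signed_indicator \<eta> B + x))
     | A B \<epsilon> \<eta> x. finite A \<and> finite B \<and> A \<noteq> {} \<and> B \<noteq> {} \<and> card A = card B \<and> card A \<le> N \<and>
         \<epsilon> \<in> unimodular \<and> \<eta> \<in> unimodular \<and> coeff_sup x \<le> 1 \<and>
         A \<inter> B = {} \<and> A \<inter> supp x = {} \<and> B \<inter> supp x = {}}"

definition norm_const :: real where
  "norm_const = (SUP (m, n)\<in>UNIV. norm (e m) * norm (e' n))"

end

end

theory Submission
  imports Defs
begin

text \<open>
  Let \<open>\<Gamma>\<close> be a greedy set for \<open>x\<close> and \<open>y\<close> a competitor supported in \<open>A\<close> with \<open>|A| \<le> N\<close>. Then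
  \<open>x - P\<^sub>\<Gamma> x = (I - P) (x - y) + P' x\<close>, where \<open>P\<close> projects onto \<open>A \<union> \<Gamma>\<close> and \<open>P'\<close> onto \<open>A - \<Gamma>\<close>. The
  coefficients of \<open>x\<close> on \<open>A - \<Gamma>\<close> are dominated by one on \<open>\<Gamma> - A\<close>, which is also a coefficient of
  \<open>x - y\<close>. So at most \<open>3 N\<close> terms occur, each of norm at most \<open>K \<parallel>x - y\<parallel>\<close>; if \<open>y = P\<^sub>A x\<close>, only
  \<open>2 N\<close> terms are needed.

  Equality holds for the summing basis of the space of convergent sequences, realised as the
  indicators of the intervals \<open>[n, \<infinity>]\<close>: the norm of a vector is the supremum of the partial sums of
  its coefficients, and \<open>K = 2\<close>. The coefficients \<open>1/2, -1, 1, -1, \<dots>\<close> have norm \<open>1/2\<close>, and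
  removing, flipping or shifting the entries \<open>-1\<close> makes the partial sums grow linearly.
\<close>

section \<open>Upper bounds for the greedy algorithm\<close>

text \<open>An admissible constant \<open>c\<close> comes without a sign. Positivity of the left
  side forces \<open>c\<close> to be positive, and only then may the error \<open>p\<close> be
  enlarged to \<open>q\<close>.\<close>

lemma le_mult_of_pos:
  fixes a c p q :: real
  assumes "0 < a" "a \<le> c * p" "0 \<le> p" "p \<le> q"
  shows "a \<le> c * q"
proof -
  have "0 < c"
    using assms(1-3) mult_nonpos_nonneg[of c p] by (cases "c \<le> 0") auto
  then have "c * p \<le> c * q"
    using assms(4) by (simp add: mult_left_mono)
  then show ?thesis
    using assms(2) by linarith
qed

context semi_normalized_system
begin

section \<open>Norm bounds for coordinate projections\<close>

lemma norm_pos: "0 < norm (e n)" "0 < norm (e' n)"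
  using semi_normalized by (metis order_less_le_trans)+

lemma dual_bounded: "\<exists>\<kappa>>0. \<forall>n. norm (e' n) \<le> \<kappa>"
  using semi_normalized by (metis order.trans order_less_le_trans norm_pos(2))

lemma norm_const_upper: "norm (e m) * norm (e' n) \<le> norm_const e e'"
proof -
  obtain \<kappa> where \<kappa>: "\<And>n. norm (e n) \<le> \<kappa>" "\<And>n. norm (e' n) \<le> \<kappa>"
    using semi_normalized by blast
  have "norm (e m) * norm (e' n) \<le> \<kappa> * \<kappa>" for m n
    by (rule mult_mono) (use \<kappa> norm_pos(1) in \<open>auto intro: order.trans[OF norm_ge_zero]\<close>)
  then have "bdd_above (range (\<lambda>(m, n). norm (e m) * norm (e' n)))"
    by (intro bdd_aboveI[of _ "\<kappa> * \<kappa>"]) auto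
  from cSUP_upper[OF UNIV_I this, of "(m, n)"] show ?thesis
    by (simp add: norm_const_def)
qed

lemma norm_const_pos: "0 < norm_const e e'"
  by (rule less_le_trans[OF mult_pos_pos[OF norm_pos] norm_const_upper])

text \<open>The map \<open>g\<close> lets the coefficient at \<open>n\<close> be bounded through a
  functional at another index; \<open>norm_const\<close> covers this because it is a supremum over
  all pairs of indices.\<close>

lemma norm_combination_le:
  assumes "\<And>n. n \<in> A \<Longrightarrow> norm (c n) \<le> norm (e' (g n)) * r" "0 \<le> r"
  shows "norm (\<Sum>n\<in>A. scale (c n) (e n)) \<le> real (card A) * (norm_const e e' * r)"
proof (rule sum_norm_bound)
  fix n assume "n \<in> A"
  have "norm (scale (c n) (e n)) \<le> (norm (e' (g n)) * r) * norm (e n)"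
    unfolding norm_scale using assms(1)[OF \<open>n \<in> A\<close>] by (intro mult_right_mono) auto
  also have "\<dots> = (norm (e n) * norm (e' (g n))) * r"
    by simp
  also have "\<dots> \<le> norm_const e e' * r"
    by (intro mult_right_mono norm_const_upper assms)
  finally show "norm (scale (c n) (e n)) \<le> norm_const e e' * r" .
qed

lemma dual_combination:
  assumes "finite A"
  shows "e' m (\<Sum>n\<in>A. scale (c n) (e n)) = (if m \<in> A then c m else 0)"
  using assms by (simp add: blinfun.sum_right dual_scale biorthogonal if_distrib cong: if_cong)

lemma proj_combination:
  assumes "finite B" "A \<subseteq> B"
  shows "proj scale e e' B (\<Sum>n\<in>A. scale (c n) (e n)) = (\<Sum>n\<in>A. scale (c n) (e n))"
  unfolding proj_def using assms finite_subset[OF assms(2,1)]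
  by (intro sum.mono_neutral_cong_right) (auto simp: dual_combination)

lemma proj_diff: "proj scale e e' A (x - y) = proj scale e e' A x - proj scale e e' A y"
  by (simp add: proj_def blinfun.diff_right scale_left_diff_distrib sum_subtractf)

lemma proj_Un_disjoint:
  assumes "finite A" "finite B" "A \<inter> B = {}"
  shows "proj scale e e' (A \<union> B) x = proj scale e e' A x + proj scale e e' B x"
  using assms by (simp add: proj_def sum.union_disjoint)

lemma dual_proj:
  assumes "finite A"
  shows "e' n (proj scale e e' A x) = (if n \<in> A then e' n x else 0)"
  using assms by (simp add: proj_def dual_combination)

lemma norm_proj_le: "norm (proj scale e e' A x) \<le> real (card A) * (norm_const e e' * norm x)"
  unfolding proj_def by (rule norm_combination_le[where g = id]) (auto simp: norm_blinfun)

text \<open>As \<Gamma> has at least as many elements as \<open>A\<close>, an index in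
  \<open>A - \<Gamma>\<close> implies one in \<open>\<Gamma> - A\<close>. A single such
  \<open>m\<close> dominates all coefficients on \<open>A - \<Gamma>\<close>. In the applications
  \<open>r\<close> is the norm of a residual that agrees with \<open>x\<close> in the coordinates
  outside \<open>A\<close>.\<close>

lemma norm_proj_diff_greedy_le:
  assumes \<Gamma>: "\<Gamma> \<in> greedy_sets e' x N" and A: "finite A" "card A \<le> N" and "0 \<le> r"
    and r: "\<And>m. m \<in> \<Gamma> - A \<Longrightarrow> norm (e' m x) \<le> norm (e' m) * r"
  shows "norm (proj scale e e' (A - \<Gamma>) x) \<le> real (card (A - \<Gamma>)) * (norm_const e e' * r)"
    and "card (A - \<Gamma>) \<le> card (\<Gamma> - A)"
proof -
  have fin: "finite \<Gamma>" "card \<Gamma> = N"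
    and greedy: "\<And>n m. n \<in> \<Gamma> \<Longrightarrow> m \<notin> \<Gamma> \<Longrightarrow> norm (e' m x) \<le> norm (e' n x)"
    using \<Gamma> by (auto simp: greedy_sets_def)
  show card: "card (A - \<Gamma>) \<le> card (\<Gamma> - A)"
    using fin A by (simp add: card_le_sym_Diff)
  show "norm (proj scale e e' (A - \<Gamma>) x) \<le> real (card (A - \<Gamma>)) * (norm_const e e' * r)"
  proof (cases "A - \<Gamma> = {}")
    case True
    show ?thesis
      unfolding True by (simp add: proj_def)
  next
    case False
    then have "card (\<Gamma> - A) \<noteq> 0"
      using card A by (metis card_0_eq finite_Diff le_zero_eq)
    then obtain m where m: "m \<in> \<Gamma> - A"
      by (metis card.empty ex_in_conv)
    show ?thesis
      unfolding proj_def
    proof (rule norm_combination_le[where g = "\<lambda>_. m"])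
      fix n assume "n \<in> A - \<Gamma>"
      then show "norm (e' n x) \<le> norm (e' m) * r"
        using greedy[of m n] r[OF m] m by auto
    qed fact
  qed
qed

lemma greedy_error_le:
  assumes \<Gamma>: "\<Gamma> \<in> greedy_sets e' x N" and A: "finite A" "card A \<le> N"
  shows "norm (x - proj scale e e' \<Gamma> x)
    \<le> (1 + 3 * norm_const e e' * real N) * norm (x - (\<Sum>n\<in>A. scale (a n) (e n)))"
proof -
  let ?P = "proj scale e e'" and ?K = "norm_const e e'"
  define y where "y = (\<Sum>n\<in>A. scale (a n) (e n))"
  have fin: "finite \<Gamma>" "card \<Gamma> = N"
    using \<Gamma> by (auto simp: greedy_sets_def)
  \<comment> \<open>The projection onto \<open>\<Gamma> \<union> A\<close> fixes \<open>y\<close>,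
    so \<open>x - y\<close> and \<open>x\<close> have the same remainder. Writing the union as a
    disjoint one splits off the part of \<open>x\<close> on \<open>A - \<Gamma>\<close>, which has
    to be put back.\<close>
  have decomp: "x - ?P \<Gamma> x = (x - y) - ?P (\<Gamma> \<union> (A - \<Gamma>)) (x - y) + ?P (A - \<Gamma>) x"
    using proj_combination[of "\<Gamma> \<union> A" A a] fin A
    by (simp add: proj_diff proj_Un_disjoint y_def[symmetric] Un_Diff_cancel)
       (simp add: proj_Un_disjoint[of \<Gamma> "A - \<Gamma>", simplified])
  have "norm (e' m x) \<le> norm (e' m) * norm (x - y)" if "m \<in> \<Gamma> - A" for m
    using that norm_blinfun[of "e' m" "x - y"] A
    by (simp add: y_def blinfun.diff_right dual_combination)
  note bnd = norm_proj_diff_greedy_le[OF \<Gamma> A norm_ge_zero this]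
  have "norm (?P (\<Gamma> \<union> (A - \<Gamma>)) (x - y))
      \<le> real (card (\<Gamma> \<union> (A - \<Gamma>))) * (?K * norm (x - y))"
    by (rule norm_proj_le)
  also have "real (card (\<Gamma> \<union> (A - \<Gamma>))) = real N + real (card (A - \<Gamma>))"
    using fin A by (subst card_Un_disjoint) auto
  finally have "norm (?P (\<Gamma> \<union> (A - \<Gamma>)) (x - y))
    \<le> (real N + real (card (A - \<Gamma>))) * (?K * norm (x - y))" .
  then have "norm (x - ?P \<Gamma> x) \<le> norm (x - y)
      + (real N + real (card (A - \<Gamma>))) * (?K * norm (x - y))
      + real (card (A - \<Gamma>)) * (?K * norm (x - y))"
    unfolding decomp using bnd(1) norm_triangle_ineq[of "x - y - ?P (\<Gamma> \<union> (A - \<Gamma>)) (x - y)" "?P (A - \<Gamma>) x"]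
      norm_triangle_ineq4[of "x - y" "?P (\<Gamma> \<union> (A - \<Gamma>)) (x - y)"] by linarith
  \<comment> \<open>The indices of \<open>A - \<Gamma>\<close> are paid for twice, once in each
    projection; this is where the factor 3 comes from.\<close>
  also have "\<dots> = norm (x - y) + (real N + 2 * real (card (A - \<Gamma>))) * (?K * norm (x - y))"
    by (simp add: algebra_simps)
  also have "\<dots> \<le> norm (x - y) + (3 * real N) * (?K * norm (x - y))"
  proof -
    have "card (A - \<Gamma>) \<le> N"
      using A by (meson card_mono Diff_subset order.trans)
    then show ?thesis
      using norm_const_pos by (intro add_left_mono mult_right_mono) auto
  qed
  finally show ?thesis
    by (simp add: y_def algebra_simps)
qed

lemma greedy_error_proj_le:
  assumes \<Gamma>: "\<Gamma> \<in> greedy_sets e' x N" and A: "finite A" "card A \<le> N"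
  shows "norm (x - proj scale e e' \<Gamma> x)
    \<le> (1 + 2 * norm_const e e' * real N) * norm (x - proj scale e e' A x)"
proof -
  let ?P = "proj scale e e'" and ?K = "norm_const e e'"
  define z where "z = x - ?P A x"
  have fin: "finite \<Gamma>" "card \<Gamma> = N"
    using \<Gamma> by (auto simp: greedy_sets_def)
  have z_coeff: "e' m z = e' m x" if "m \<notin> A" for m
    using that A by (simp add: z_def blinfun.diff_right dual_proj)
  \<comment> \<open>The part on \<open>A \<inter> \<Gamma>\<close> is subtracted in both residuals
    and cancels. On \<open>\<Gamma> - A\<close> the coefficients of \<open>x\<close> are those of
    \<open>z\<close>, so two projections remain, each onto at most \<open>N\<close> indices.\<close>
  have "?P \<Gamma> x = ?P (\<Gamma> - A) x + ?P (A \<inter> \<Gamma>) x" "?P A x = ?P (A - \<Gamma>) x + ?P (A \<inter> \<Gamma>) x"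
    using fin A by (subst proj_Un_disjoint[symmetric]; auto intro: arg_cong[where f = "\<lambda>S. ?P S x"])+
  moreover have "?P (\<Gamma> - A) x = ?P (\<Gamma> - A) z"
    by (simp add: proj_def z_coeff)
  ultimately have "x - ?P \<Gamma> x = z + ?P (A - \<Gamma>) x - ?P (\<Gamma> - A) z"
    by (simp add: z_def)
  then have "norm (x - ?P \<Gamma> x) \<le> norm z + norm (?P (A - \<Gamma>) x) + norm (?P (\<Gamma> - A) z)"
    using norm_triangle_ineq4[of "z + ?P (A - \<Gamma>) x" "?P (\<Gamma> - A) z"]
      norm_triangle_ineq[of z "?P (A - \<Gamma>) x"] by simp
  moreover have "norm (e' m x) \<le> norm (e' m) * norm z" if "m \<in> \<Gamma> - A" for m
    using that norm_blinfun[of "e' m" z] by (simp add: z_coeff)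
  note bnd = norm_proj_diff_greedy_le[OF \<Gamma> A norm_ge_zero this]
  have "real (card (A - \<Gamma>)) * (?K * norm z) \<le> real N * (?K * norm z)"
    "real (card (\<Gamma> - A)) * (?K * norm z) \<le> real N * (?K * norm z)"
    using A fin norm_const_pos
    by (intro mult_right_mono; force intro: order.trans[OF card_mono[OF _ Diff_subset]])+
  ultimately have "norm (x - ?P \<Gamma> x) \<le> norm z + 2 * (real N * (?K * norm z))"
    using bnd(1) norm_proj_le[of "\<Gamma> - A" z] by linarith
  then show ?thesis
    by (simp add: z_def algebra_simps)
qed

section \<open>Upper bounds for the Lebesgue constants\<close>

lemma lebesgue_const_le: "lebesgue_const scale e e' N \<le> ereal (1 + 3 * norm_const e e' * real N)"
  unfolding lebesgue_const_def
proof (rule INF_lower, intro CollectI allI ballI)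
  fix x G assume "G \<in> greedy_maps scale e e' N"
  then obtain \<Gamma> where \<Gamma>: "\<Gamma> \<in> greedy_sets e' x N" "G x = proj scale e e' \<Gamma> x"
    by (auto simp: greedy_maps_def)
  let ?C = "1 + 3 * norm_const e e' * real N"
  have C: "0 < ?C"
    using norm_const_pos by (simp add: add_pos_nonneg)
  \<comment> \<open>\<open>infdist\<close> is 0 by convention for the empty set, so it equals the
    infimum of the distances only once the set is known to be nonempty.\<close>
  have "{} \<noteq> sparse_vectors scale e N"
    by (auto simp: sparse_vectors_def intro!: exI[of _ "{}"])
  \<comment> \<open>Division by the positive constant turns the estimate into a lower bound common
    to all competitors, which passes to the infimum.\<close>
  moreover have "norm (x - G x) / ?C \<le> dist x y" if y: "y \<in> sparse_vectors scale e N" for y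
    using y C greedy_error_le[OF \<Gamma>(1)] unfolding \<Gamma>(2)
    by (auto simp: sparse_vectors_def divide_le_eq dist_norm mult.commute)
  ultimately have "norm (x - G x) / ?C \<le> best_error scale e N x"
    unfolding best_error_def infdist_def by (auto intro: cINF_greatest)
  then show "norm (x - G x) \<le> ?C * best_error scale e N x"
    using C by (simp add: divide_le_eq mult.commute)
qed

lemma lebesgue_const_proj_le:
  "lebesgue_const_proj scale e e' N \<le> ereal (1 + 2 * norm_const e e' * real N)"
  unfolding lebesgue_const_proj_def
proof (rule INF_lower, intro CollectI allI ballI)
  fix x G assume "G \<in> greedy_maps scale e e' N"
  then obtain \<Gamma> where \<Gamma>: "\<Gamma> \<in> greedy_sets e' x N" "G x = proj scale e e' \<Gamma> x"
    by (auto simp: greedy_maps_def)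
  let ?C = "1 + 2 * norm_const e e' * real N"
  have C: "0 < ?C"
    using norm_const_pos by (simp add: add_pos_nonneg)
  have "norm (x - G x) / ?C \<le> proj_error scale e e' N x"
    unfolding proj_error_def
  proof (rule cINF_greatest)
    show "{A::nat set. finite A \<and> card A \<le> N} \<noteq> {}"
      by (auto intro!: exI[of _ "{}"])
  next
    fix A :: "nat set" assume "A \<in> {A. finite A \<and> card A \<le> N}"
    then show "norm (x - G x) / ?C \<le> norm (x - proj scale e e' A x)"
      using C greedy_error_proj_le[OF \<Gamma>(1)] unfolding \<Gamma>(2)
      by (auto simp: divide_le_eq mult.commute)
  qed
  then show "norm (x - G x) \<le> ?C * proj_error scale e e' N x"
    using C by (simp add: divide_le_eq mult.commute)
qed

lemma proj_error_le:
  assumes "finite A" "card A \<le> N"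
  shows "proj_error scale e e' N x \<le> norm (x - proj scale e e' A x)"
  unfolding proj_error_def using assms by (intro cINF_lower) (auto intro: bdd_belowI[of _ 0])

lemma proj_error_nonneg: "0 \<le> proj_error scale e e' N x"
  unfolding proj_error_def by (rule cINF_greatest) (auto intro!: exI[of _ "{}"])

section \<open>Existence of greedy sets and greedy maps\<close>

lemma finite_supp_span:
  assumes "x \<in> span (range e)"
  shows "finite (supp e' x)"
  using assms
proof (induction rule: span_induct_alt)
  case base
  then show ?case
    by (simp add: supp_def)
next
  case (step c x y)
  then obtain k where "x = e k"
    by blast
  then have "supp e' (scale c x + y) \<subseteq> insert k (supp e' y)"
    by (auto simp: supp_def blinfun.add_right dual_scale biorthogonal)
  then show ?case
    using step finite_subset by blast
qed

text \<open>This is the convergence of the coefficients to 0. A vector \<open>y\<close> of the span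
  within \<open>\<delta> / \<kappa>\<close> of \<open>x\<close> changes every coefficient by less
  than \<delta>, so each large coefficient of \<open>x\<close> remains nonzero in \<open>y\<close>,
  whose support is finite.\<close>

lemma finite_large_coeffs:
  assumes "0 < \<delta>"
  shows "finite {n. \<delta> \<le> norm (e' n x)}"
proof -
  obtain \<kappa> where \<kappa>: "0 < \<kappa>" "\<And>n. norm (e' n) \<le> \<kappa>"
    using dual_bounded by blast
  have "x \<in> closure (span (range e))"
    using dense_span by simp
  then obtain y where y: "y \<in> span (range e)" "dist y x < \<delta> / \<kappa>"
    unfolding closure_approachable using assms \<kappa>(1) by (meson divide_pos_pos)
  have "{n. \<delta> \<le> norm (e' n x)} \<subseteq> supp e' y"
  proof
    fix n assume "n \<in> {n. \<delta> \<le> norm (e' n x)}"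
    moreover have "norm (e' n (x - y)) < \<delta>"
    proof -
      have "norm (e' n (x - y)) \<le> norm (e' n) * norm (x - y)"
        by (rule norm_blinfun)
      also have "\<dots> \<le> \<kappa> * norm (x - y)"
        using \<kappa> by (simp add: mult_right_mono)
      also have "\<dots> < \<delta>"
        using y(2) \<kappa>(1) by (simp add: dist_norm norm_minus_commute field_simps)
      finally show ?thesis .
    qed
    ultimately show "n \<in> supp e' y"
      by (auto simp: supp_def blinfun.diff_right)
  qed
  then show ?thesis
    using finite_supp_span[OF y(1)] finite_subset by blast
qed

text \<open>A greedy set grows by adjoining an index of a largest remaining coefficient. The maximum
  is attained because only finitely many coefficients are as large as a given nonzero one.\<close>

lemma greedy_sets_nonempty: "\<exists>\<Gamma>. \<Gamma> \<in> greedy_sets e' x N"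
proof (induction N)
  case 0
  show ?case
    by (auto simp: greedy_sets_def intro!: exI[of _ "{}"])
next
  case (Suc N)
  then obtain \<Gamma> where \<Gamma>: "finite \<Gamma>" "card \<Gamma> = N"
    "\<And>n m. n \<in> \<Gamma> \<Longrightarrow> m \<notin> \<Gamma> \<Longrightarrow> norm (e' m x) \<le> norm (e' n x)"
    by (auto simp: greedy_sets_def)
  have "\<exists>k. k \<notin> \<Gamma> \<and> (\<forall>m. m \<notin> \<Gamma> \<longrightarrow> norm (e' m x) \<le> norm (e' k x))"
  proof (cases "\<forall>m. m \<notin> \<Gamma> \<longrightarrow> e' m x = 0")
    case True
    obtain k where "k \<notin> \<Gamma>"
      using \<Gamma>(1) ex_new_if_finite infinite_UNIV_nat by blast
    then show ?thesis
      using True by auto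
  next
    case False
    then obtain j where j: "j \<notin> \<Gamma>" "e' j x \<noteq> 0"
      by blast
    define S where "S = {m. m \<notin> \<Gamma> \<and> norm (e' j x) \<le> norm (e' m x)}"
    have "finite S"
      using j(2) by (intro finite_subset[OF _ finite_large_coeffs[of "norm (e' j x)" x]])
        (auto simp: S_def)
    moreover have "S \<noteq> {}"
      using j by (auto simp: S_def)
    ultimately have "Max ((\<lambda>m. norm (e' m x)) ` S) \<in> (\<lambda>m. norm (e' m x)) ` S"
      by (intro Max_in) auto
    then obtain k where "k \<in> S" "norm (e' k x) = Max ((\<lambda>m. norm (e' m x)) ` S)"
      by auto
    then have k: "k \<in> S" "\<And>m. m \<in> S \<Longrightarrow> norm (e' m x) \<le> norm (e' k x)"
      using \<open>finite S\<close> by auto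
    have "norm (e' m x) \<le> norm (e' k x)" if "m \<notin> \<Gamma>" for m
      using that k by (cases "m \<in> S") (auto simp: S_def)
    then show ?thesis
      using k(1) by (auto simp: S_def)
  qed
  then obtain k where k: "k \<notin> \<Gamma>" "\<And>m. m \<notin> \<Gamma> \<Longrightarrow> norm (e' m x) \<le> norm (e' k x)"
    by blast
  have "insert k \<Gamma> \<in> greedy_sets e' x (Suc N)"
    using \<Gamma> k by (auto simp: greedy_sets_def)
  then show ?case
    by blast
qed

text \<open>The Lebesgue constants quantify over maps defined on the whole space. To test them at
  one point with a prescribed greedy set, the map is completed elsewhere by choice.\<close>

lemma greedy_map_extending:
  assumes "\<Gamma> \<in> greedy_sets e' x N"
  obtains G where "G \<in> greedy_maps scale e e' N" "G x = proj scale e e' \<Gamma> x"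
proof
  let ?G = "\<lambda>y. proj scale e e' (if y = x then \<Gamma> else SOME \<Gamma>. \<Gamma> \<in> greedy_sets e' y N) y"
  show "?G \<in> greedy_maps scale e e' N"
    unfolding greedy_maps_def
  proof (intro CollectI allI)
    fix y
    show "\<exists>\<Gamma>\<in>greedy_sets e' y N. ?G y = proj scale e e' \<Gamma> y"
      using assms someI_ex[OF greedy_sets_nonempty[of y N]] by (cases "y = x") auto
  qed
  show "?G x = proj scale e e' \<Gamma> x"
    by simp
qed

section \<open>The democracy constant as a lower bound\<close>

lemma dual_signed_indicator:
  assumes "finite A"
  shows "e' n (signed_indicator scale e \<epsilon> A) = (if n \<in> A then \<epsilon> n else 0)"
  using assms by (simp add: signed_indicator_def dual_combination)

lemma signed_indicator_add_nonzero:
  assumes "finite A" "A \<noteq> {}" "A \<inter> supp e' x = {}" "\<epsilon> \<in> unimodular"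
  shows "signed_indicator scale e \<epsilon> A + x \<noteq> 0"
proof
  obtain n where n: "n \<in> A"
    using assms by blast
  assume "signed_indicator scale e \<epsilon> A + x = 0"
  then have "e' n (signed_indicator scale e \<epsilon> A + x) = 0"
    by simp
  then have "\<epsilon> n = 0"
    using n assms by (auto simp: blinfun.add_right dual_signed_indicator supp_def)
  moreover have "norm (\<epsilon> n) = 1"
    using assms(4) by (simp add: unimodular_def)
  ultimately show False
    by simp
qed

text \<open>A set disjoint from everything in sight pads \<open>A\<close> and \<open>B\<close> to the cardinality \<open>N\<close> that greedy
  maps demand; finiteness of the support makes room for it.\<close>

lemma democracy_finite_supp:
  assumes C: "\<And>x G. G \<in> greedy_maps scale e e' N \<Longrightarrow> norm (x - G x) \<le> C * proj_error scale e e' N x"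
    and fin: "finite A" "finite B" "A \<noteq> {}" and card: "card A = card B" "card A \<le> N"
    and uni: "\<epsilon> \<in> unimodular" "\<eta> \<in> unimodular"
    and v: "finite (supp e' v)" "\<And>n. norm (e' n v) \<le> 1"
    and disj: "A \<inter> B = {}" "A \<inter> supp e' v = {}" "B \<inter> supp e' v = {}"
  shows "norm (signed_indicator scale e \<epsilon> A + v) \<le> C * norm (signed_indicator scale e \<eta> B + v)"
proof -
  let ?P = "proj scale e e'" and ?I = "signed_indicator scale e"
  have "infinite (UNIV - (A \<union> B \<union> supp e' v))"
    using fin v by (intro Diff_infinite_finite infinite_UNIV_nat) simp
  then obtain D where D: "finite D" "card D = N - card A" "D \<subseteq> UNIV - (A \<union> B \<union> supp e' v)"
    using infinite_arbitrarily_large by blast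
  \<comment> \<open>All coefficients of \<open>y\<close> have modulus 1 on \<open>A\<close>,
    \<open>B\<close> and \<open>D\<close> and at most 1 elsewhere. Hence \<open>B \<union> D\<close>
    is greedy; removing it leaves the numerator vector, while removing \<open>A \<union> D\<close>
    instead leaves the denominator vector.\<close>
  define y where "y = ?I \<epsilon> A + ?I \<eta> B + ?I (\<lambda>_. 1) D + v"
  have y_coeff: "e' n y = (if n \<in> A then \<epsilon> n else if n \<in> B then \<eta> n else if n \<in> D then 1 else e' n v)" for n
    using disj D fin by (auto simp: y_def blinfun.add_right dual_signed_indicator supp_def)
  have norm_uni: "norm (\<epsilon> n) = 1" "norm (\<eta> n) = 1" for n
    using uni by (auto simp: unimodular_def)
  have PA: "?P (A \<union> D) y = ?I \<epsilon> A + ?I (\<lambda>_. 1) D"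
  proof -
    have "?P A y = ?I \<epsilon> A" "?P D y = ?I (\<lambda>_. 1) D"
      using D disj by (auto simp: proj_def signed_indicator_def y_coeff intro!: sum.cong)
    then show ?thesis
      using D fin by (subst proj_Un_disjoint) auto
  qed
  have PB: "?P (B \<union> D) y = ?I \<eta> B + ?I (\<lambda>_. 1) D"
  proof -
    have "?P B y = ?I \<eta> B" "?P D y = ?I (\<lambda>_. 1) D"
      using D disj by (auto simp: proj_def signed_indicator_def y_coeff intro!: sum.cong)
    then show ?thesis
      using D fin by (subst proj_Un_disjoint) auto
  qed
  have cards: "card (A \<union> D) = N" "card (B \<union> D) = N"
    using D fin card by (subst card_Un_disjoint; auto)+
  have "B \<union> D \<in> greedy_sets e' y N"
    using fin D cards disj v(2) by (auto simp: greedy_sets_def y_coeff norm_uni)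
  then obtain G where G: "G \<in> greedy_maps scale e e' N" "G y = ?P (B \<union> D) y"
    by (rule greedy_map_extending)
  have "y - G y = ?I \<epsilon> A + v"
    by (simp add: G(2) PB) (simp add: y_def)
  then have 1: "norm (?I \<epsilon> A + v) \<le> C * proj_error scale e e' N y"
    using C[OF G(1), of y] by simp
  have "y - ?P (A \<union> D) y = ?I \<eta> B + v"
    by (simp add: PA) (simp add: y_def)
  then have 2: "proj_error scale e e' N y \<le> norm (?I \<eta> B + v)"
    using proj_error_le[of "A \<union> D" N y] cards fin D by simp
  have "0 < norm (?I \<epsilon> A + v)"
    using signed_indicator_add_nonzero fin disj uni by simp
  from le_mult_of_pos[OF this 1 proj_error_nonneg 2] show ?thesis .
qed

text \<open>Plain approximation from the span may put mass on \<open>F\<close> and push coefficients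
  above 1. The first defect is removed by subtracting the projection onto \<open>F\<close>, which is
  continuous and vanishes at \<open>x\<close>; the second by a rescaling that tends to 1.\<close>

lemma finite_supp_approximation:
  assumes "finite F" "F \<inter> supp e' x = {}" "\<And>n. norm (e' n x) \<le> 1"
  obtains v where "v \<longlonglongrightarrow> x" "\<And>k. finite (supp e' (v k))" "\<And>k. F \<inter> supp e' (v k) = {}"
    "\<And>k n. norm (e' n (v k)) \<le> 1"
proof -
  let ?P = "proj scale e e'"
  obtain \<kappa> where \<kappa>: "0 < \<kappa>" "\<And>n. norm (e' n) \<le> \<kappa>"
    using dual_bounded by blast
  have "x \<in> closure (span (range e))"
    using dense_span by simp
  then obtain u where u: "\<And>k. u k \<in> span (range e)" "u \<longlonglongrightarrow> x"
    unfolding closure_sequential by blast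
  define w where "w k = u k - ?P F (u k)" for k
  have w_coeff: "e' n (w k) = (if n \<in> F then 0 else e' n (u k))" for n k
    using assms(1) by (simp add: w_def blinfun.diff_right dual_proj)
  have "?P F x = 0"
    using assms(2) by (auto simp: proj_def supp_def intro!: sum.neutral)
  then have "w k - x = (u k - x) - ?P F (u k - x)" for k
    by (simp add: w_def proj_diff)
  then have w_tri: "norm (w k - x) \<le> norm (u k - x) + norm (?P F (u k - x))" for k
    by (metis norm_triangle_ineq4)
  have w_le: "norm (w k - x) \<le> (1 + real (card F) * norm_const e e') * norm (u k - x)" for k
    using w_tri[of k] norm_proj_le[of F "u k - x"] by (simp add: algebra_simps)
  have u_lim: "(\<lambda>k. norm (u k - x)) \<longlonglongrightarrow> 0"
    using u(2) by (simp add: LIM_zero tendsto_norm_zero)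
  have w_lim: "(\<lambda>k. norm (w k - x)) \<longlonglongrightarrow> 0"
    by (rule Lim_null_comparison[OF _ tendsto_mult_right_zero[OF u_lim,
          of "1 + real (card F) * norm_const e e'"]]) (simp add: w_le)
  \<comment> \<open>\<open>s k\<close> bounds every coefficient of \<open>w k\<close>, since those
    of \<open>x\<close> are at most 1 and those of \<open>w k - x\<close> at most
    \<open>\<kappa> * norm (w k - x)\<close>.\<close>
  define s where "s k = 1 + \<kappa> * norm (w k - x)" for k
  have s: "1 \<le> s k" for k
    using \<kappa>(1) by (simp add: s_def)
  have s_lim: "s \<longlonglongrightarrow> 1"
    unfolding s_def using tendsto_add[OF tendsto_const tendsto_mult_right_zero[OF w_lim]] by simp
  show thesis
  proof
    have "w \<longlonglongrightarrow> x"
      using w_lim by (simp add: LIM_zero_iff tendsto_norm_zero_iff)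
    from tendsto_scaleR[OF tendsto_inverse[OF s_lim] this]
    show "(\<lambda>k. inverse (s k) *\<^sub>R w k) \<longlonglongrightarrow> x"
      by simp
    fix k
    have "supp e' (inverse (s k) *\<^sub>R w k) \<subseteq> supp e' (u k) - F"
      by (auto simp: supp_def blinfun.scaleR_right w_coeff split: if_splits)
    then show "finite (supp e' (inverse (s k) *\<^sub>R w k))" "F \<inter> supp e' (inverse (s k) *\<^sub>R w k) = {}"
      using finite_supp_span[OF u(1)] by (auto intro: finite_subset)
    fix n
    have "norm (e' n (w k)) \<le> norm (e' n x) + norm (e' n (w k - x))"
      using norm_triangle_ineq[of "e' n x" "e' n (w k - x)"] by (simp add: blinfun.diff_right)
    also have "norm (e' n (w k - x)) \<le> norm (e' n) * norm (w k - x)"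
      by (rule norm_blinfun)
    also have "\<dots> \<le> \<kappa> * norm (w k - x)"
      using \<kappa>(2) by (simp add: mult_right_mono)
    finally have "norm (e' n (w k)) \<le> s k"
      using assms(3)[of n] by (simp add: s_def)
    then show "norm (e' n (inverse (s k) *\<^sub>R w k)) \<le> 1"
      using s[of k] by (simp add: blinfun.scaleR_right field_simps)
  qed
qed

text \<open>The real supremum is informative only for a set bounded above, which holds by the
  uniform bound on the functionals.\<close>

lemma norm_coeff_le_coeff_sup: "norm (e' n x) \<le> coeff_sup e' x"
proof -
  obtain \<kappa> where \<kappa>: "0 < \<kappa>" "\<And>n. norm (e' n) \<le> \<kappa>"
    using dual_bounded by blast
  have "norm (e' n x) \<le> \<kappa> * norm x" for n
    using norm_blinfun[of "e' n" x] \<kappa>(2)[of n] by (meson mult_right_mono norm_ge_zero order.trans)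
  then have "bdd_above (range (\<lambda>n. norm (e' n x)))"
    by (intro bdd_aboveI2)
  then show ?thesis
    unfolding coeff_sup_def by (rule cSUP_upper[OF UNIV_I])
qed

lemma democracy_const_le_lebesgue_const_proj:
  "democracy_const scale e e' N \<le> lebesgue_const_proj scale e e' N"
  unfolding democracy_const_def lebesgue_const_proj_def
proof (intro INF_greatest Sup_least, elim CollectE exE conjE)
  fix C q A B \<epsilon> \<eta> x
  assume "\<forall>x. \<forall>G\<in>greedy_maps scale e e' N. norm (x - G x) \<le> C * proj_error scale e e' N x"
  then have C: "\<And>x G. G \<in> greedy_maps scale e e' N \<Longrightarrow> norm (x - G x) \<le> C * proj_error scale e e' N x"
    by blast
  assume q: "q = ereal (norm (signed_indicator scale e \<epsilon> A + x) / norm (signed_indicator scale e \<eta> B + x))"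
    and fin: "finite A" "finite B" "A \<noteq> {}" "B \<noteq> {}" and card: "card A = card B" "card A \<le> N"
    and uni: "\<epsilon> \<in> unimodular" "\<eta> \<in> unimodular" and x: "coeff_sup e' x \<le> 1"
    and disj: "A \<inter> B = {}" "A \<inter> supp e' x = {}" "B \<inter> supp e' x = {}"
  let ?I = "signed_indicator scale e"
  have "(A \<union> B) \<inter> supp e' x = {}" "\<And>n. norm (e' n x) \<le> 1"
    using disj x norm_coeff_le_coeff_sup order.trans by (blast, blast)
  then obtain v where v: "v \<longlonglongrightarrow> x" "\<And>k. finite (supp e' (v k))"
    "\<And>k. (A \<union> B) \<inter> supp e' (v k) = {}" "\<And>k n. norm (e' n (v k)) \<le> 1"
    using finite_supp_approximation[of "A \<union> B" x] fin by blast
  \<comment> \<open>With finitely supported \<open>v k\<close> in place of \<open>x\<close> there is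
    room for the padding set; both sides are continuous, so the inequality survives the
    limit.\<close>
  have "norm (?I \<epsilon> A + v k) \<le> C * norm (?I \<eta> B + v k)" for k
    by (rule democracy_finite_supp[OF _ fin(1-3) card uni v(2) v(4) disj(1)]) (use C v(3)[of k] in auto)
  moreover have "(\<lambda>k. norm (?I \<epsilon> A + v k)) \<longlonglongrightarrow> norm (?I \<epsilon> A + x)"
    "(\<lambda>k. C * norm (?I \<eta> B + v k)) \<longlonglongrightarrow> C * norm (?I \<eta> B + x)"
    by (intro tendsto_intros v(1))+
  ultimately have "norm (?I \<epsilon> A + x) \<le> C * norm (?I \<eta> B + x)"
    by (intro LIMSEQ_le) auto
  moreover have "0 < norm (?I \<eta> B + x)"
    using signed_indicator_add_nonzero fin disj uni by simp
  ultimately show "q \<le> ereal C"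
    by (simp add: q divide_le_eq)
qed

end

section \<open>The summing basis of the space of convergent sequences\<close>

unbundle bcontfun.lifting

lift_definition bcontfun_scale ::
    "'k::real_normed_algebra \<Rightarrow> ('t::topological_space \<Rightarrow>\<^sub>C 'k) \<Rightarrow> ('t \<Rightarrow>\<^sub>C 'k)"
  is "\<lambda>c f t. c * f t"
proof -
  fix c and f :: "'t \<Rightarrow> 'k"
  assume "f \<in> bcontfun"
  then have "continuous_on UNIV f" "bounded (range f)"
    by (auto simp: bcontfun_def)
  then have "continuous_on UNIV (\<lambda>t. c * f t)" "bounded ((\<lambda>y. c * y) ` range f)"
    by (auto intro: continuous_on_mult_left bounded_linear_image bounded_linear_mult_right)
  then show "(\<lambda>t. c * f t) \<in> bcontfun"
    by (simp add: bcontfun_def image_image)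
qed

lemma apply_bcontfun_sum: "apply_bcontfun (\<Sum>i\<in>A. f i) t = (\<Sum>i\<in>A. apply_bcontfun (f i) t)"
  by (induction A rule: infinite_finite_induct) auto

lemma complete_UNIV_bcontfun: "complete (UNIV :: ('t::topological_space \<Rightarrow>\<^sub>C 'b::complete_space) set)"
proof (rule completeI)
  fix f :: "nat \<Rightarrow> 't \<Rightarrow>\<^sub>C 'b"
  assume "Cauchy f"
  then have "uniformly_Cauchy_on UNIV (\<lambda>n. apply_bcontfun (f n))"
    unfolding Cauchy_def uniformly_Cauchy_on_def by (meson dist_fun_lt_imp_dist_val_lt)
  then obtain g where "uniform_limit UNIV (\<lambda>n. apply_bcontfun (f n)) g sequentially"
    using Cauchy_uniformly_convergent unfolding uniformly_convergent_on_def by blast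
  then obtain l where "f \<longlonglongrightarrow> l"
    using uniform_limit_bcontfunE sequentially_bot by metis
  then show "\<exists>l\<in>UNIV. f \<longlonglongrightarrow> l"
    by blast
qed

text \<open>One inequality is pointwise; applied to the inverse scalar it gives the other.\<close>

lemma norm_bcontfun_scale:
  fixes f :: "'t::topological_space \<Rightarrow>\<^sub>C 'k::real_normed_field"
  shows "norm (bcontfun_scale c f) = norm c * norm f"
proof (cases "c = 0")
  case True
  then have "bcontfun_scale c f = 0"
    by (intro bcontfun_eqI) (simp add: bcontfun_scale.rep_eq)
  then show ?thesis
    using True by simp
next
  case False
  have le: "norm (bcontfun_scale c f) \<le> norm c * norm f" for c and f :: "'t \<Rightarrow>\<^sub>C 'k"
    by (rule norm_bound) (simp add: bcontfun_scale.rep_eq norm_mult mult_left_mono norm_bounded)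
  have "f = bcontfun_scale (inverse c) (bcontfun_scale c f)"
    using False by (intro bcontfun_eqI) (simp add: bcontfun_scale.rep_eq)
  then have "norm f \<le> norm (inverse c) * norm (bcontfun_scale c f)"
    using le by metis
  then have "norm c * norm f \<le> norm c * (norm (inverse c) * norm (bcontfun_scale c f))"
    by (simp add: mult_left_mono)
  also have "\<dots> = norm (bcontfun_scale c f)"
    using False by (simp add: norm_inverse)
  finally show ?thesis
    using le by (simp add: antisym)
qed

lemma banach_space_over_bcontfun:
  "banach_space_over (bcontfun_scale ::
     'k::{real_normed_field,banach} \<Rightarrow> ('t::topological_space \<Rightarrow>\<^sub>C 'k) \<Rightarrow> _)"
  by unfold_locales
    (auto intro!: bcontfun_eqI complete_UNIV_bcontfun
      simp: bcontfun_scale.rep_eq algebra_simps norm_bcontfun_scale scaleR_conv_of_real)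

section \<open>Basis vectors and coordinate functionals\<close>

lift_definition tail_indicator :: "nat \<Rightarrow> enat \<Rightarrow>\<^sub>C 'k::real_normed_algebra_1"
  is "\<lambda>n t. if enat n \<le> t then 1 else 0"
proof (rule bcontfun_normI)
  fix n :: nat
  let ?f = "\<lambda>t. if enat n \<le> t then 1 else 0 :: 'k"
  \<comment> \<open>Only sets containing \<infinity> carry a condition for openness: they must
    contain a ray, and the function is constant on this one.\<close>
  have "{enat n<..} \<subseteq> ?f -` B" if "\<infinity> \<in> ?f -` B" for B
    using that by auto
  then have "open (?f -` B)" for B
    unfolding open_enat_iff by blast
  then show "continuous_on UNIV ?f"
    by (simp add: continuous_on_open_vimage)
qed (auto intro: norm_ge_zero order.refl simp: norm_one)

lemma increment_bound:
  "norm (apply_bcontfun f (enat n) - (if n = 0 then 0 else apply_bcontfun f (enat (n - 1)))) \<le> 2 * norm f"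
  for f :: "enat \<Rightarrow>\<^sub>C 'b::real_normed_vector"
  using norm_bounded[of f "enat n"] norm_bounded[of f "enat (n - 1)"] norm_ge_zero[of f]
    norm_triangle_ineq4[of "apply_bcontfun f (enat n)" "apply_bcontfun f (enat (n - 1))"]
  unfolding mult_2 by (cases "n = 0") (simp_all del: norm_ge_zero)

text \<open>The jump of \<open>f\<close> at \<open>n\<close>, with the value before 0 taken to be 0,
  so that sums of jumps telescope to values of \<open>f\<close>.\<close>

lift_definition increment :: "nat \<Rightarrow> (enat \<Rightarrow>\<^sub>C 'k::real_normed_field) \<Rightarrow>\<^sub>L 'k"
  is "\<lambda>n f. apply_bcontfun f (enat n) - (if n = 0 then 0 else apply_bcontfun f (enat (n - 1)))"
proof (rule bounded_linear_intro[where K = 2])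
  fix n and f :: "enat \<Rightarrow>\<^sub>C 'k"
  show "norm (apply_bcontfun f (enat n) - (if n = 0 then 0 else apply_bcontfun f (enat (n - 1))))
      \<le> norm f * 2"
    using increment_bound[of f n] by (simp add: mult.commute)
qed (auto simp: algebra_simps)

lemma norm_tail_indicator: "norm (tail_indicator n :: enat \<Rightarrow>\<^sub>C 'k::real_normed_algebra_1) = 1"
proof (rule antisym)
  show "norm (tail_indicator n :: enat \<Rightarrow>\<^sub>C 'k) \<le> 1"
    by (rule norm_bound) (simp add: tail_indicator.rep_eq)
  show "1 \<le> norm (tail_indicator n :: enat \<Rightarrow>\<^sub>C 'k)"
    using norm_bounded[of "tail_indicator n :: enat \<Rightarrow>\<^sub>C 'k" \<infinity>] by (simp add: tail_indicator.rep_eq)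
qed

lemma increment_tail_indicator: "increment m (tail_indicator n) = (if m = n then 1 else 0)"
  by (auto simp: increment.rep_eq tail_indicator.rep_eq)

lemma increment_bcontfun_scale: "increment n (bcontfun_scale c f) = c * increment n f"
  by (simp add: increment.rep_eq bcontfun_scale.rep_eq algebra_simps)

lemma norm_increment_le: "norm (increment n :: (enat \<Rightarrow>\<^sub>C 'k::real_normed_field) \<Rightarrow>\<^sub>L 'k) \<le> 2"
  by (rule norm_blinfun_bound) (simp_all add: increment.rep_eq increment_bound del: One_nat_def)

lemma norm_increment_ge: "1 \<le> norm (increment n :: (enat \<Rightarrow>\<^sub>C 'k::real_normed_field) \<Rightarrow>\<^sub>L 'k)"
  using norm_blinfun[of "increment n" "tail_indicator n :: enat \<Rightarrow>\<^sub>C 'k"]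
  by (simp add: increment_tail_indicator norm_tail_indicator)

lemma norm_increment_1: "norm (increment 1 :: (enat \<Rightarrow>\<^sub>C 'k::real_normed_field) \<Rightarrow>\<^sub>L 'k) = 2"
proof (rule antisym[OF norm_increment_le])
  \<comment> \<open>This function is -1 at 0 and 1 from 1 on: norm 1, with a jump of 2. Index 1 is
    the first where two values are compared.\<close>
  let ?f = "bcontfun_scale 2 (tail_indicator 1) - tail_indicator 0 :: enat \<Rightarrow>\<^sub>C 'k"
  have "norm ?f \<le> 1"
    by (rule norm_bound) (simp add: bcontfun_scale.rep_eq tail_indicator.rep_eq enat_0)
  moreover have "increment 1 ?f = 2"
    by (simp add: increment.rep_eq bcontfun_scale.rep_eq tail_indicator.rep_eq)
  ultimately show "2 \<le> norm (increment 1 :: (enat \<Rightarrow>\<^sub>C 'k) \<Rightarrow>\<^sub>L 'k)"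
    using norm_blinfun[of "increment 1" ?f] mult_left_le[of "norm ?f" "norm (increment 1 :: (enat \<Rightarrow>\<^sub>C 'k) \<Rightarrow>\<^sub>L 'k)"]
    by simp
qed

lemma bcontfun_enat_tail:
  fixes f :: "enat \<Rightarrow>\<^sub>C 'b::metric_space"
  assumes "0 < \<delta>"
  obtains N where "\<And>t. enat N \<le> t \<Longrightarrow> dist (apply_bcontfun f t) (apply_bcontfun f \<infinity>) < \<delta>"
proof -
  let ?V = "apply_bcontfun f -` ball (apply_bcontfun f \<infinity>) \<delta>"
  have "open ?V"
    by (intro open_vimage open_ball continuous_on_apply_bcontfun)
  moreover have "\<infinity> \<in> ?V"
    using assms by simp
  ultimately obtain N :: nat where N: "{enat N<..} \<subseteq> ?V"
    unfolding open_enat_iff by blast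
  show thesis
  proof
    \<comment> \<open>The neighbourhood of \<infinity> is a strict ray, hence the successor as
      witness.\<close>
    fix t assume "enat (Suc N) \<le> t"
    then have "enat N < t"
      by (metis Suc_ile_eq)
    then show "dist (apply_bcontfun f t) (apply_bcontfun f \<infinity>) < \<delta>"
      using N by (auto simp: dist_commute)
  qed
qed

lemma sum_increment:
  "(\<Sum>n\<le>m. increment n f) = apply_bcontfun f (enat m)"
  by (induction m) (auto simp: increment.rep_eq)

text \<open>At \<open>t\<close> only the terms with \<open>n \<le> m\<close> and
  \<open>enat n \<le> t\<close> contribute, and their increments telescope. The partial sum is thus
  \<open>f\<close> stopped at \<open>m\<close>.\<close>

lemma summing_partial_sum:
  "apply_bcontfun (\<Sum>n\<le>m. bcontfun_scale (increment n f) (tail_indicator n)) t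
    = apply_bcontfun f (min (enat m) t)"
proof -
  have "apply_bcontfun (\<Sum>n\<le>m. bcontfun_scale (increment n f) (tail_indicator n)) t
    = (\<Sum>n\<in>{..m} \<inter> {n. enat n \<le> t}. increment n f)"
    by (simp add: apply_bcontfun_sum bcontfun_scale.rep_eq tail_indicator.rep_eq sum.If_cases
        if_distrib cong: if_cong)
  also have "\<exists>k. {..m} \<inter> {n. enat n \<le> t} = {..k} \<and> enat k = min (enat m) t"
  proof (cases t)
    case (enat k)
    then show ?thesis
      by (intro exI[of _ "min m k"]) auto
  next
    case infinity
    then show ?thesis
      by (intro exI[of _ m]) auto
  qed
  then have "(\<Sum>n\<in>{..m} \<inter> {n. enat n \<le> t}. increment n f) = apply_bcontfun f (min (enat m) t)"
    using sum_increment by metis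
  finally show ?thesis .
qed

interpretation bcontfun: banach_space_over
  "bcontfun_scale :: 'k::{real_normed_field,banach} \<Rightarrow> ('t::topological_space \<Rightarrow>\<^sub>C 'k) \<Rightarrow> _"
  by (rule banach_space_over_bcontfun)

lemma closure_span_tail_indicator:
  "closure (module.span bcontfun_scale
     (range (tail_indicator :: nat \<Rightarrow> enat \<Rightarrow>\<^sub>C 'k::{real_normed_field,banach}))) = UNIV"
proof (intro set_eqI iffI UNIV_I)
  fix f :: "enat \<Rightarrow>\<^sub>C 'k"
  show "f \<in> closure (module.span bcontfun_scale (range tail_indicator))"
    unfolding closure_approachable
  proof (intro allI impI)
    fix \<delta> :: real assume "0 < \<delta>"
    \<comment> \<open>Stopping at \<open>m\<close> changes \<open>f\<close> only beyond
      \<open>m\<close>, where any two values differ by less than \<open>\<delta> / 2\<close>. The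
      remaining slack restores the strict inequality lost in the supremum.\<close>
    then obtain m where m: "\<And>t. enat m \<le> t \<Longrightarrow> dist (apply_bcontfun f t) (apply_bcontfun f \<infinity>) < \<delta> / 4"
      using bcontfun_enat_tail[of "\<delta> / 4" f] by auto
    let ?g = "\<Sum>n\<le>m. bcontfun_scale (increment n f) (tail_indicator n)"
    have "dist (apply_bcontfun ?g t) (apply_bcontfun f t) \<le> \<delta> / 2" for t
    proof (cases t "enat m" rule: le_cases)
      case le
      then show ?thesis
        using \<open>0 < \<delta>\<close> by (simp add: summing_partial_sum min_absorb2)
    next
      case ge
      then have "dist (apply_bcontfun f (enat m)) (apply_bcontfun f t) \<le> \<delta> / 4 + \<delta> / 4"
        using dist_triangle2[of "apply_bcontfun f (enat m)" "apply_bcontfun f t" "apply_bcontfun f \<infinity>"]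
          m[of "enat m"] m[of t] by simp
      then show ?thesis
        using ge by (simp add: summing_partial_sum min_absorb1)
    qed
    then have "dist ?g f \<le> \<delta> / 2"
      by (rule dist_bound)
    moreover have "?g \<in> module.span bcontfun_scale (range tail_indicator)"
      by (intro bcontfun.span_sum bcontfun.span_scale bcontfun.span_base) auto
    ultimately show "\<exists>g\<in>module.span bcontfun_scale (range tail_indicator). dist g f < \<delta>"
      using \<open>0 < \<delta>\<close> by (intro bexI[of _ ?g]) auto
  qed
qed

interpretation summing: semi_normalized_system
  "bcontfun_scale :: 'k::{real_normed_field,banach} \<Rightarrow> (enat \<Rightarrow>\<^sub>C 'k) \<Rightarrow> _"
  tail_indicator increment
proof
  show "\<exists>\<kappa>1 \<kappa>2. 0 < \<kappa>1 \<and> (\<forall>n. \<kappa>1 \<le> norm (tail_indicator n :: enat \<Rightarrow>\<^sub>C 'k)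
      \<and> norm (tail_indicator n :: enat \<Rightarrow>\<^sub>C 'k) \<le> \<kappa>2
      \<and> \<kappa>1 \<le> norm (increment n :: (enat \<Rightarrow>\<^sub>C 'k) \<Rightarrow>\<^sub>L 'k)
      \<and> norm (increment n :: (enat \<Rightarrow>\<^sub>C 'k) \<Rightarrow>\<^sub>L 'k) \<le> \<kappa>2)"
    by (intro exI[of _ 1] exI[of _ 2]) (simp add: norm_tail_indicator norm_increment_le norm_increment_ge)
qed (auto simp: increment_tail_indicator increment_bcontfun_scale closure_span_tail_indicator)

lemma norm_const_summing:
  "norm_const tail_indicator
     (increment :: nat \<Rightarrow> (enat \<Rightarrow>\<^sub>C 'k::{real_normed_field,banach}) \<Rightarrow>\<^sub>L 'k) = 2"
proof (rule antisym)
  show "norm_const tail_indicator (increment :: nat \<Rightarrow> (enat \<Rightarrow>\<^sub>C 'k) \<Rightarrow>\<^sub>L 'k) \<le> 2"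
    unfolding norm_const_def by (rule cSUP_least) (auto simp: norm_tail_indicator norm_increment_le)
  show "2 \<le> norm_const tail_indicator (increment :: nat \<Rightarrow> (enat \<Rightarrow>\<^sub>C 'k) \<Rightarrow>\<^sub>L 'k)"
    using summing.norm_const_upper[of 0 1, where 'k = 'k]
    by (simp add: norm_tail_indicator norm_increment_1 del: One_nat_def)
qed

section \<open>The zigzag vector\<close>

text \<open>The initial 1/2 centres the partial sums at 0, so they alternate between 1/2 and -1/2
  although all later coefficients have modulus 1.\<close>

definition zigzag_coeff :: "nat \<Rightarrow> 'k::real_normed_field" where
  "zigzag_coeff n = (if n = 0 then 1 / 2 else (- 1) ^ n)"

definition zigzag :: "nat \<Rightarrow> enat \<Rightarrow>\<^sub>C 'k::real_normed_field" where
  "zigzag m = (\<Sum>n\<le>m. bcontfun_scale (zigzag_coeff n) (tail_indicator n))"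

lemma sum_zigzag_coeff: "(\<Sum>n\<le>m. zigzag_coeff n) = ((- 1) ^ m / 2 :: 'k::real_normed_field)"
  by (induction m) (auto simp: zigzag_coeff_def field_simps)

lemma norm_zigzag_coeff_le: "norm (zigzag_coeff n) \<le> 1"
  by (simp add: zigzag_coeff_def norm_divide norm_power)

lemma combination_at_infinity:
  "apply_bcontfun (\<Sum>n\<in>A. bcontfun_scale (c n) (tail_indicator n)) \<infinity> = (\<Sum>n\<in>A. c n)"
  by (simp add: apply_bcontfun_sum bcontfun_scale.rep_eq tail_indicator.rep_eq)

lemma signed_indicator_at_infinity:
  "apply_bcontfun (signed_indicator bcontfun_scale tail_indicator \<epsilon> A) \<infinity> = (\<Sum>n\<in>A. \<epsilon> n)"
  by (simp add: signed_indicator_def combination_at_infinity)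

lemma zigzag_at_infinity: "apply_bcontfun (zigzag m) \<infinity> = ((- 1) ^ m / 2 :: 'k::real_normed_field)"
  by (simp add: zigzag_def combination_at_infinity sum_zigzag_coeff)

lemma increment_zigzag:
  "increment n (zigzag m :: enat \<Rightarrow>\<^sub>C 'k::{real_normed_field,banach})
    = (if n \<le> m then zigzag_coeff n else 0)"
  by (simp add: zigzag_def summing.dual_combination)

lemma norm_zigzag_le:
  "norm (zigzag m :: enat \<Rightarrow>\<^sub>C 'k::{real_normed_field,banach}) \<le> 1 / 2"
proof (rule norm_bound)
  fix t
  have "min (enat m) t \<le> enat m"
    by simp
  then obtain k where k: "min (enat m) t = enat k"
    using enat_ile by blast
  \<comment> \<open>Once \<open>zigzag m\<close> is written as its own expansion, its value at any
    \<open>t\<close> is a partial sum of the coefficients.\<close>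
  have "zigzag m = (\<Sum>n\<le>m. bcontfun_scale (increment n (zigzag m :: enat \<Rightarrow>\<^sub>C 'k)) (tail_indicator n))"
    unfolding zigzag_def[of m] by (rule sum.cong) (auto simp: increment_zigzag simp flip: zigzag_def)
  then have "apply_bcontfun (zigzag m :: enat \<Rightarrow>\<^sub>C 'k) t = apply_bcontfun (zigzag m) (enat k)"
    using summing_partial_sum k by metis
  also have "\<dots> = (\<Sum>n\<le>k. increment n (zigzag m))"
    by (simp add: sum_increment)
  also have "\<dots> = (\<Sum>n\<le>k. zigzag_coeff n)"
    using k by (intro sum.cong) (auto simp: increment_zigzag min_def split: if_splits)
  also have "\<dots> = (- 1) ^ k / 2"
    by (rule sum_zigzag_coeff)
  finally have "apply_bcontfun (zigzag m :: enat \<Rightarrow>\<^sub>C 'k) t = (- 1) ^ k / 2" .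
  then show "norm (apply_bcontfun (zigzag m :: enat \<Rightarrow>\<^sub>C 'k) t) \<le> 1 / 2"
    by (simp only: norm_divide norm_power) simp
qed

text \<open>Odd positions in consecutive blocks, on which the zigzag coefficients are -1.\<close>

definition odds :: "nat \<Rightarrow> nat \<Rightarrow> nat set" where
  "odds i j = (\<lambda>k. 2 * k + 1) ` {i..<j}"

lemma finite_odds [simp]: "finite (odds i j)"
  by (simp add: odds_def)

lemma card_odds [simp]: "card (odds i j) = j - i"
  by (simp add: odds_def card_image inj_on_def)

lemma odds_less: "n \<in> odds i j \<Longrightarrow> n < 2 * j"
  by (auto simp: odds_def)

lemma zigzag_coeff_odds: "n \<in> odds i j \<Longrightarrow> zigzag_coeff n = (- 1 :: 'k::real_normed_field)"
  by (auto simp: odds_def zigzag_coeff_def)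

section \<open>Lower bounds for the summing basis\<close>

text \<open>Deleting the \<open>N\<close> entries -1 from the zigzag raises its total from 1/2 to
  \<open>N + 1/2\<close>, and \<open>N\<close> new entries 1 raise it to \<open>2 * N + 1/2\<close>.
  Restoring the deleted entries gives the zigzag of norm at most 1/2, so the quotient is at least
  \<open>1 + 4 * N\<close>.\<close>

lemma democracy_const_summing_ge:
  assumes "1 \<le> N"
  shows "ereal (1 + 4 * real N) \<le> democracy_const
    (bcontfun_scale :: 'k::{real_normed_field,banach} \<Rightarrow> (enat \<Rightarrow>\<^sub>C 'k) \<Rightarrow> _) tail_indicator increment N"
proof -
  let ?I = "signed_indicator (bcontfun_scale :: 'k \<Rightarrow> (enat \<Rightarrow>\<^sub>C 'k) \<Rightarrow> _) tail_indicator"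
  \<comment> \<open>The new entries lie beyond the last index \<open>2 * N\<close> of the zigzag,
    which makes the supports disjoint.\<close>
  define A where "A = {2 * N + 1..<3 * N + 1}"
  define B where "B = odds 0 N"
  define z where "z = (zigzag (2 * N) :: enat \<Rightarrow>\<^sub>C 'k)"
  define x where "x = z - ?I (\<lambda>_. - 1) B"
  have fin: "finite A" "finite B" "card A = N" "card B = N"
    by (simp_all add: A_def B_def)
  have x_coeff: "increment n x = (if n \<le> 2 * N \<and> n \<notin> B then zigzag_coeff n else 0)" for n
    using fin zigzag_coeff_odds[of n 0 N, where 'k = 'k] odds_less[of n 0 N]
    by (auto simp: x_def z_def blinfun.diff_right increment_zigzag summing.dual_signed_indicator B_def)
  have disj: "A \<inter> B = {}" "A \<inter> supp increment x = {}" "B \<inter> supp increment x = {}"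
    using odds_less[of _ 0 N] by (fastforce simp: A_def B_def supp_def x_coeff)+
  have uni: "(\<lambda>_. 1) \<in> (unimodular :: (nat \<Rightarrow> 'k) set)" "(\<lambda>_. - 1) \<in> (unimodular :: (nat \<Rightarrow> 'k) set)"
    by (simp_all add: unimodular_def)
  have sup: "coeff_sup increment x \<le> 1"
    unfolding coeff_sup_def by (rule cSUP_least) (auto simp: x_coeff norm_zigzag_coeff_le)
  have nonempty: "A \<noteq> {}" "B \<noteq> {}"
    using fin assms by auto
  have "ereal (norm (?I (\<lambda>_. 1) A + x) / norm (?I (\<lambda>_. - 1) B + x))
      \<le> democracy_const bcontfun_scale tail_indicator (increment :: nat \<Rightarrow> (enat \<Rightarrow>\<^sub>C 'k) \<Rightarrow>\<^sub>L 'k) N"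
    unfolding democracy_const_def
    by (rule Sup_upper, rule CollectI, (rule exI)+, intro conjI, rule refl)
       (use fin nonempty uni sup disj in simp_all)
  moreover have "1 + 4 * real N \<le> norm (?I (\<lambda>_. 1) A + x) / norm (?I (\<lambda>_. - 1) B + x)"
  proof -
    have z: "?I (\<lambda>_. - 1) B + x = z"
      by (simp add: x_def)
    have "apply_bcontfun (?I (\<lambda>_. 1) A + x) \<infinity> = of_real (2 * real N + 1 / 2)"
      using fin by (simp add: x_def z_def signed_indicator_at_infinity zigzag_at_infinity)
    then have "2 * real N + 1 / 2 \<le> norm (?I (\<lambda>_. 1) A + x)"
      using norm_bounded[of "?I (\<lambda>_. 1) A + x" \<infinity>] by (simp only: norm_of_real)
    \<comment> \<open>A zero denominator would make the quotient 0 by convention.\<close>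
    moreover have "z \<noteq> 0"
      using zigzag_at_infinity[of "2 * N", where 'k = 'k] by (auto simp: z_def)
    ultimately have "(2 * real N + 1 / 2) / (1 / 2) \<le> norm (?I (\<lambda>_. 1) A + x) / norm z"
      using norm_zigzag_le[of "2 * N", where 'k = 'k] by (intro frac_le) (auto simp: z_def)
    then show ?thesis
      unfolding z by simp
  qed
  ultimately show ?thesis
    by (meson ereal_less_eq(3) order.trans)
qed

text \<open>Among \<open>2 * N\<close> entries -1 of the zigzag the last \<open>N\<close> are
  flipped to 1 by adding \<open>y\<close>, which raises the total by \<open>2 * N\<close>; greedy
  removal of the first \<open>N\<close> adds another \<open>N\<close>. The competitor
  \<open>y\<close> leaves only the zigzag, of norm at most 1/2, whence the ratio
  \<open>1 + 6 * N\<close>.\<close>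

lemma lebesgue_const_summing_ge:
  "ereal (1 + 6 * real N) \<le> lebesgue_const
    (bcontfun_scale :: 'k::{real_normed_field,banach} \<Rightarrow> (enat \<Rightarrow>\<^sub>C 'k) \<Rightarrow> _) tail_indicator increment N"
  unfolding lebesgue_const_def
proof (rule INF_greatest, elim CollectE)
  fix C
  assume C: "\<forall>x::enat \<Rightarrow>\<^sub>C 'k. \<forall>G\<in>greedy_maps bcontfun_scale tail_indicator increment N.
    norm (x - G x) \<le> C * best_error bcontfun_scale tail_indicator N x"
  define \<Gamma> where "\<Gamma> = odds 0 N"
  define A where "A = odds N (2 * N)"
  define z where "z = (zigzag (4 * N) :: enat \<Rightarrow>\<^sub>C 'k)"
  define y where "y = (\<Sum>n\<in>A. bcontfun_scale 2 (tail_indicator n) :: enat \<Rightarrow>\<^sub>C 'k)"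
  define x where "x = z + y"
  have fin: "finite A" "finite \<Gamma>" "card A = N" "card \<Gamma> = N"
    by (simp_all add: A_def \<Gamma>_def)
  have "A \<inter> \<Gamma> = {}"
    by (auto simp: A_def \<Gamma>_def odds_def)
  have x_coeff: "increment n x =
      (if n \<in> A then 1 else if n \<in> \<Gamma> then - 1 else if n \<le> 4 * N then zigzag_coeff n else 0)" for n
    using \<open>A \<inter> \<Gamma> = {}\<close> fin zigzag_coeff_odds[of n 0 N, where 'k = 'k] odds_less[of n 0 N]
      zigzag_coeff_odds[of n N "2 * N", where 'k = 'k] odds_less[of n N "2 * N"]
    by (auto simp: x_def y_def z_def blinfun.add_right increment_zigzag summing.dual_combination A_def \<Gamma>_def)
  \<comment> \<open>All coefficients have modulus at most 1, with equality on \<Gamma>; the tie with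
    \<open>A\<close> allows the unfavourable choice.\<close>
  have "\<Gamma> \<in> greedy_sets increment x N"
    using fin \<open>A \<inter> \<Gamma> = {}\<close> by (auto simp: greedy_sets_def x_coeff norm_zigzag_coeff_le)
  then obtain G where G: "G \<in> greedy_maps bcontfun_scale tail_indicator increment N"
    "G x = proj bcontfun_scale tail_indicator increment \<Gamma> x"
    by (rule summing.greedy_map_extending)
  have G_eq: "G x = (\<Sum>n\<in>\<Gamma>. bcontfun_scale (- 1) (tail_indicator n))"
    unfolding G(2) proj_def using \<open>A \<inter> \<Gamma> = {}\<close> by (intro sum.cong) (auto simp: x_coeff)
  have "apply_bcontfun (G x) \<infinity> = (\<Sum>n\<in>\<Gamma>. - 1)"
    unfolding G_eq by (rule combination_at_infinity)
  then have "apply_bcontfun (G x) \<infinity> = - of_nat N"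
    using fin by simp
  moreover have "apply_bcontfun y \<infinity> = (\<Sum>n\<in>A. 2)"
    unfolding y_def by (rule combination_at_infinity)
  then have "apply_bcontfun y \<infinity> = of_nat N * 2"
    using fin by simp
  moreover have "apply_bcontfun z \<infinity> = 1 / 2"
    by (simp add: z_def zigzag_at_infinity)
  moreover have "apply_bcontfun (x - G x) \<infinity>
      = apply_bcontfun z \<infinity> + apply_bcontfun y \<infinity> - apply_bcontfun (G x) \<infinity>"
    by (simp add: x_def)
  ultimately have "apply_bcontfun (x - G x) \<infinity> = of_real (3 * real N + 1 / 2)"
    by simp
  then have "3 * real N + 1 / 2 \<le> norm (x - G x)"
    using norm_bounded[of "x - G x" \<infinity>] by (simp only: norm_of_real)
  also have "\<dots> \<le> C * best_error bcontfun_scale tail_indicator N x"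
    using C G(1) by blast
  finally have 1: "3 * real N + 1 / 2 \<le> C * best_error bcontfun_scale tail_indicator N x" .
  have "y \<in> sparse_vectors bcontfun_scale tail_indicator N"
    unfolding sparse_vectors_def y_def
    by (rule CollectI, (rule exI)+, intro conjI, rule refl) (simp_all add: fin)
  then have "best_error bcontfun_scale tail_indicator N x \<le> dist x y"
    unfolding best_error_def by (rule infdist_le)
  also have "\<dots> \<le> 1 / 2"
    using norm_zigzag_le[of "4 * N", where 'k = 'k] by (simp add: dist_norm x_def z_def)
  finally have 2: "best_error bcontfun_scale tail_indicator N x \<le> 1 / 2" .
  have "3 * real N + 1 / 2 \<le> C * (1 / 2)"
    by (rule le_mult_of_pos[OF _ 1 _ 2]) (simp_all add: best_error_def infdist_nonneg)
  then show "ereal (1 + 6 * real N) \<le> ereal C"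
    by simp
qed

theorem theorem1p8:
  fixes scale :: "'k::{real_normed_field,banach} \<Rightarrow> 'a::real_normed_vector \<Rightarrow> 'a"
    and e :: "nat \<Rightarrow> 'a" and e' :: "nat \<Rightarrow> 'a \<Rightarrow>\<^sub>L 'k"
  shows "(semi_normalized_system scale e e' \<longrightarrow>
           (\<forall>N\<ge>1.
             lebesgue_const scale e e' N \<le> ereal (1 + 3 * norm_const e e' * real N) \<and>
             democracy_const scale e e' N \<le> lebesgue_const_proj scale e e' N \<and>
             lebesgue_const_proj scale e e' N \<le> ereal (1 + 2 * norm_const e e' * real N))) \<and>
         (\<exists>(scl :: 'k \<Rightarrow> (enat \<Rightarrow>\<^sub>C 'k) \<Rightarrow> (enat \<Rightarrow>\<^sub>C 'k)) f f'.
           semi_normalized_system scl f f' \<and>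
           (\<forall>N\<ge>1.
             lebesgue_const scl f f' N = ereal (1 + 3 * norm_const f f' * real N) \<and>
             democracy_const scl f f' N = lebesgue_const_proj scl f f' N \<and>
             lebesgue_const_proj scl f f' N = ereal (1 + 2 * norm_const f f' * real N)))"
proof (intro conjI impI allI exI)
  fix N :: nat
  assume "semi_normalized_system scale e e'"
  then interpret semi_normalized_system scale e e' .
  show "lebesgue_const scale e e' N \<le> ereal (1 + 3 * norm_const e e' * real N)"
    by (rule lebesgue_const_le)
  show "democracy_const scale e e' N \<le> lebesgue_const_proj scale e e' N"
    by (rule democracy_const_le_lebesgue_const_proj)
  show "lebesgue_const_proj scale e e' N \<le> ereal (1 + 2 * norm_const e e' * real N)"
    by (rule lebesgue_const_proj_le)
next
  let ?s = "bcontfun_scale :: 'k \<Rightarrow> (enat \<Rightarrow>\<^sub>C 'k) \<Rightarrow> (enat \<Rightarrow>\<^sub>C 'k)"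
  show "semi_normalized_system ?s tail_indicator increment"
    by (rule summing.semi_normalized_system_axioms)
  fix N :: nat assume N: "1 \<le> N"
  show "lebesgue_const ?s tail_indicator increment N
      = ereal (1 + 3 * norm_const tail_indicator (increment :: nat \<Rightarrow> (enat \<Rightarrow>\<^sub>C 'k) \<Rightarrow>\<^sub>L 'k) * real N)"
    using summing.lebesgue_const_le[of N, where 'k = 'k] lebesgue_const_summing_ge[of N, where 'k = 'k]
    by (simp add: norm_const_summing)
  \<comment> \<open>With \<open>norm_const\<close> equal to 2 these three inequalities form a closed
    chain, so both equalities follow at once.\<close>
  note le = summing.democracy_const_le_lebesgue_const_proj[of N, where 'k = 'k]
    summing.lebesgue_const_proj_le[of N, where 'k = 'k]
    democracy_const_summing_ge[OF N, where 'k = 'k]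
  show "democracy_const ?s tail_indicator increment N
      = lebesgue_const_proj ?s tail_indicator increment N"
    using le by (simp add: norm_const_summing)
  show "lebesgue_const_proj ?s tail_indicator increment N
      = ereal (1 + 2 * norm_const tail_indicator (increment :: nat \<Rightarrow> (enat \<Rightarrow>\<^sub>C 'k) \<Rightarrow>\<^sub>L 'k) * real N)"
    using le by (simp add: norm_const_summing)
qed

end
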